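(* Let $a_1,a_2,c_1,c_2\in\mathbb{R}$ satisfy $a_1<a_2$, $c_1<c_2$, $a_1+c_1<0$, $a_2+c_2>0$, let $p^i(x)=a_ix_1^2+c_ix_2^2$, $i=1,2$, on $\mathbb{R}^2$, and let $$P(x_1,x_2):=p^1(x_1,x_2)+p^2(x_2,x_1)=(a_1+c_2)x_1^2+(c_1+a_2)x_2^2 .$$ Consider the double obstacle problem with obstacles $p^1\le p^2$. Case 1) If $P\equiv0$, there are infinitely many rotationally invariant halfspace solutions corresponding to $p^1$, and likewise to $p^2$. Case 2) If $P$ changes sign, there are infinitely many halfspace solutions corresponding to $p^1$, and likewise to $p^2$. Case 3) Suppose $P$ has a sign. If $P\ge0$, there are infinitely many rotationally invariant halfspace solutions corresponding to $p^1$, and at most two halfspace solutions corresponding to $p^2$. Similarly, if $P\le0$, there are infinitely many rotationally invariant halfspace solutions corresponding to $p^2$, and at most two halfspace solutions corresponding to $p^1$.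
   Context: A polynomial $P$ has a sign if $P\not\equiv0$ and either $P\ge0$ everywhere or $P\le 0$ everywhere. Let $\lambda_i=\Delta p^i$, so $\lambda_1<0<\lambda_2$. A function $u$ on $\mathbb{R}^2$ is a halfspace solution to the double obstacle problem corresponding to $p^1$ if $u\le p^2$ in $\mathbb{R}^2$ and $u-p^1=-\frac{\lambda_1}{2}(x\cdot e)_+^2$ for a unit vector $e$; it is a halfspace solution corresponding to $p^2$ if $u\ge p^1$ in $\mathbb{R}^2$ and $p^2-u=\frac{\lambda_2}{2}(x\cdot e)_+^2$ for a unit vector $e$. For a halfspace solution corresponding to $p^i$, let $\varGamma_i=\partial\{u\neq p^i\}=\{x\cdot e=0\}$. "Rotationally invariant halfspace solutions corresponding to $p^i$" means that the line $\varGamma_i$ can be any line through the origin. *)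

theory Defs
  imports "HOL-Analysis.Analysis"
begin

definition laplacian :: "('a::euclidean_space \<Rightarrow> real) \<Rightarrow> 'a \<Rightarrow> real" where
  "laplacian f x = (\<Sum>b\<in>Basis. (deriv ^^ 2) (\<lambda>t::real. f (x + t *\<^sub>R b)) 0)"

text \<open>The two obstacles are \<open>p1 \<le> p2\<close>. They are meant to be quadratic
  polynomials, so that the Laplacians \<open>\<lambda>\<^sub>1\<close>, \<open>\<lambda>\<^sub>2\<close> below do not depend on the point.\<close>

definition halfspace_solution_lower ::
    "(real^2 \<Rightarrow> real) \<Rightarrow> (real^2 \<Rightarrow> real) \<Rightarrow> (real^2 \<Rightarrow> real) \<Rightarrow> bool" where
  "halfspace_solution_lower p1 p2 u \<longleftrightarrow>
     (\<forall>x. u x \<le> p2 x) \<and>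
     (\<exists>e. norm e = 1 \<and> (\<forall>x. u x - p1 x = - (laplacian p1 x / 2) * (max (x \<bullet> e) 0)\<^sup>2))"

definition halfspace_solution_upper ::
    "(real^2 \<Rightarrow> real) \<Rightarrow> (real^2 \<Rightarrow> real) \<Rightarrow> (real^2 \<Rightarrow> real) \<Rightarrow> bool" where
  "halfspace_solution_upper p1 p2 u \<longleftrightarrow>
     (\<forall>x. u x \<ge> p1 x) \<and>
     (\<exists>e. norm e = 1 \<and> (\<forall>x. p2 x - u x = laplacian p2 x / 2 * (max (x \<bullet> e) 0)\<^sup>2))"

definition free_boundary :: "(real^2 \<Rightarrow> real) \<Rightarrow> (real^2 \<Rightarrow> real) \<Rightarrow> (real^2) set" where
  "free_boundary p u = frontier {x. u x \<noteq> p x}"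

text \<open>A set \<open>S\<close> of halfspace solutions corresponding to \<open>p\<close> is rotationally invariant
  in the sense that the free boundary can be any line through the origin.\<close>

definition rotationally_invariant ::
    "(real^2 \<Rightarrow> real) \<Rightarrow> (real^2 \<Rightarrow> real) set \<Rightarrow> bool" where
  "rotationally_invariant p S \<longleftrightarrow>
     (\<forall>L. subspace L \<and> dim L = 1 \<longrightarrow> (\<exists>u\<in>S. free_boundary p u = L))"

definition has_sign :: "('a \<Rightarrow> real) \<Rightarrow> bool" where
  "has_sign P \<longleftrightarrow> (\<exists>x. P x \<noteq> 0) \<and> ((\<forall>x. P x \<ge> 0) \<or> (\<forall>x. P x \<le> 0))"

definition changes_sign :: "('a \<Rightarrow> real) \<Rightarrow> bool" where
  "changes_sign P \<longleftrightarrow> (\<exists>x. P x > 0) \<and> (\<exists>x. P x < 0)"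

end

(* A halfspace solution with direction e differs from its obstacle by d (x . e)_+^2, where d > 0 is
   half of the absolute value of the Laplacian, and it respects the other obstacle iff
   d (x . e)^2 <= alpha x_1^2 + gamma x_2^2, with alpha = a2 - a1 and gamma = c2 - c1. By
   Cauchy-Schwarz this means d (e_1^2 / alpha + e_2^2 / gamma) <= 1. For unit vectors e the latter
   says that the quadratic form with coefficients 1 - d / alpha, 1 - d / gamma is nonnegative at e,
   and these coefficients have, up to positive factors, the signs of the coefficients of P
   (for p1) or of -P (for p2). *)

theory Submission
  imports Defs
begin

section \<open>Diagonal quadratic forms\<close>

text \<open>This one family contains both obstacles, their difference, the dual form with reciprocal
  coefficients, and \<open>P\<close>.\<close>

definition diag_form :: "real \<Rightarrow> real \<Rightarrow> real^2 \<Rightarrow> real" where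
  "diag_form a c = (\<lambda>x. a * (x $ 1)\<^sup>2 + c * (x $ 2)\<^sup>2)"

lemma second_deriv_quadratic:
  fixes f :: "real \<Rightarrow> real"
  assumes "\<And>t. f t = A + B * t + C * t\<^sup>2"
  shows "(deriv ^^ 2) f 0 = 2 * C"
proof -
  have "deriv f = (\<lambda>t. B + 2 * C * t)"
    unfolding assms
    by (intro ext DERIV_imp_deriv) (auto intro!: derivative_eq_intros)
  moreover have "deriv (\<lambda>t. B + 2 * C * t) 0 = 2 * C"
    by (intro DERIV_imp_deriv) (auto intro!: derivative_eq_intros)
  ultimately show ?thesis
    by (simp add: numeral_2_eq_2)
qed

lemma Basis_real_2: "(Basis :: (real^2) set) = {axis 1 1, axis 2 1}"
  by (auto simp: Basis_vec_def UNIV_2)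

lemma laplacian_diag_form: "laplacian (diag_form a c) x = 2 * (a + c)"
proof -
  have "(deriv ^^ 2) (\<lambda>t. diag_form a c (x + t *\<^sub>R axis 1 1)) 0 = 2 * a"
    \<comment> \<open>\<open>A\<close> and \<open>B\<close> are the value and the slope at t = 0 of
      the restriction to the coordinate line; the second derivative sees only the coefficient of
      t^2.\<close>
    by (rule second_deriv_quadratic[where A = "diag_form a c x" and B = "2 * a * x $ 1"])
      (simp add: diag_form_def axis_def power2_eq_square algebra_simps)
  moreover have "(deriv ^^ 2) (\<lambda>t. diag_form a c (x + t *\<^sub>R axis 2 1)) 0 = 2 * c"
    by (rule second_deriv_quadratic[where A = "diag_form a c x" and B = "2 * c * x $ 2"])
      (simp add: diag_form_def axis_def power2_eq_square algebra_simps)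
  ultimately show ?thesis
    unfolding laplacian_def Basis_real_2 by (simp add: axis_eq_axis)
qed

lemma inner_real_2: "(x :: real^2) \<bullet> y = x $ 1 * y $ 1 + x $ 2 * y $ 2"
  by (simp add: inner_vec_def sum_2)

lemma norm_eq_1_iff_2: "norm (e :: real^2) = 1 \<longleftrightarrow> (e $ 1)\<^sup>2 + (e $ 2)\<^sup>2 = 1"
  by (simp add: norm_eq_1 inner_real_2 power2_eq_square)

text \<open>A weighted Lagrange identity: the difference of the two sides is a square divided by the
  positive number \<alpha> \<gamma>.\<close>

lemma Cauchy_Schwarz_weighted:
  fixes x e :: "real^2"
  assumes "0 < \<alpha>" "0 < \<gamma>"
  shows "(x \<bullet> e)\<^sup>2 \<le> diag_form (1/\<alpha>) (1/\<gamma>) e * diag_form \<alpha> \<gamma> x"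
proof -
  have "diag_form (1/\<alpha>) (1/\<gamma>) e * diag_form \<alpha> \<gamma> x - (x \<bullet> e)\<^sup>2
      = (\<gamma> * e $ 1 * x $ 2 - \<alpha> * e $ 2 * x $ 1)\<^sup>2 / (\<alpha> * \<gamma>)"
    using assms by (simp add: diag_form_def inner_real_2 field_simps power2_eq_square)
  also have "\<dots> \<ge> 0"
    using assms by simp
  finally show ?thesis
    by simp
qed

text \<open>The dual form at \<open>e\<close> is the maximum of the quotient of (x . e)^2 by
  \<open>diag_form \<alpha> \<gamma> x\<close> over nonzero \<open>x\<close>. It is attained where x
  . e > 0, so passing to the positive part does not weaken the constraint.\<close>

lemma ramp_le_diag_form_iff:
  fixes e :: "real^2"
  assumes "0 < \<alpha>" "0 < \<gamma>" "0 < d" "e \<noteq> 0"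
  shows "(\<forall>x. d * (max (x \<bullet> e) 0)\<^sup>2 \<le> diag_form \<alpha> \<gamma> x)
    \<longleftrightarrow> d * diag_form (1/\<alpha>) (1/\<gamma>) e \<le> 1" (is "?L \<longleftrightarrow> d * ?S \<le> 1")
proof
  have "e $ 1 \<noteq> 0 \<or> e $ 2 \<noteq> 0"
    using \<open>e \<noteq> 0\<close> by (auto simp: vec_eq_iff forall_2)
  then have S: "?S > 0"
    using assms by (auto simp: diag_form_def add_pos_nonneg add_nonneg_pos)
  \<comment> \<open>the equality case of Cauchy-Schwarz\<close>
  define x :: "real^2" where "x = vector [e $ 1 / \<alpha>, e $ 2 / \<gamma>]"
  have "x \<bullet> e = ?S" "diag_form \<alpha> \<gamma> x = ?S"
    using assms by (auto simp: x_def inner_real_2 diag_form_def power2_eq_square)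
  moreover assume ?L
  ultimately have "d * ?S\<^sup>2 \<le> ?S"
    using S by (metis max.absorb1 less_imp_le)
  with S show "d * ?S \<le> 1"
    by (simp add: power2_eq_square mult.assoc[symmetric])
next
  assume S: "d * ?S \<le> 1"
  show ?L
  proof
    fix x :: "real^2"
    have q: "0 \<le> diag_form \<alpha> \<gamma> x"
      using assms by (simp add: diag_form_def)
    have "(max (x \<bullet> e) 0)\<^sup>2 \<le> (x \<bullet> e)\<^sup>2"
      by (simp add: max_def)
    also have "\<dots> \<le> ?S * diag_form \<alpha> \<gamma> x"
      using assms by (intro Cauchy_Schwarz_weighted)
    finally have "d * (max (x \<bullet> e) 0)\<^sup>2 \<le> d * ?S * diag_form \<alpha> \<gamma> x"
      using \<open>0 < d\<close> by (simp add: mult.assoc)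
    also have "\<dots> \<le> diag_form \<alpha> \<gamma> x"
      using mult_right_mono[OF S q] by simp
    finally show "d * (max (x \<bullet> e) 0)\<^sup>2 \<le> diag_form \<alpha> \<gamma> x" .
  qed
qed

section \<open>Admissible directions\<close>

text \<open>These are the unit vectors whose ramp respects the opposite obstacle: \<alpha> and
  \<gamma> are the coefficients of the gap between the obstacles, and \<open>d\<close> is half of
  the absolute value of the Laplacian.\<close>

definition directions :: "real \<Rightarrow> real \<Rightarrow> real \<Rightarrow> (real^2) set" where
  "directions \<alpha> \<gamma> d = {e. norm e = 1 \<and> d * diag_form (1/\<alpha>) (1/\<gamma>) e \<le> 1}"

text \<open>The constant 1 is homogenised as the squared norm of \<open>e\<close>, so that only the
  signs of two coefficients matter.\<close>

lemma directions_eq: "directions \<alpha> \<gamma> d = {e. norm e = 1 \<and> 0 \<le> diag_form (1 - d/\<alpha>) (1 - d/\<gamma>) e}"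
  unfolding directions_def norm_eq_1_iff_2 diag_form_def
  by (auto simp: algebra_simps)

lemma directions_eq_sphere:
  assumes "0 < \<alpha>" "0 < \<gamma>" "d \<le> \<alpha>" "d \<le> \<gamma>"
  shows "directions \<alpha> \<gamma> d = sphere 0 1"
  using assms by (auto simp: directions_eq diag_form_def)

text \<open>The directions \<open>(1, s)\<close> with small \<open>s\<close>, normalised.\<close>

lemma infinite_diag_form_nonneg:
  assumes "0 < k \<or> 0 \<le> k \<and> 0 \<le> l"
  shows "infinite {e. norm e = 1 \<and> 0 \<le> diag_form k l e}"
proof -
  obtain \<delta> where \<delta>: "0 < \<delta>" "\<And>s. s \<in> {0<..<\<delta>} \<Longrightarrow> 0 \<le> k + l * s\<^sup>2"
  proof (cases "0 < k")
    case True
    have "((\<lambda>s. k + l * s\<^sup>2) \<longlongrightarrow> k + l * 0\<^sup>2) (at_right 0)"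
      by (intro tendsto_intros)
    then have "\<forall>\<^sub>F s in at_right 0. 0 < k + l * s\<^sup>2"
      using True by (intro order_tendstoD) auto
    then show thesis
      using that by (auto simp: eventually_at_right_field intro: less_imp_le)
  next
    case False
    then show thesis
      \<comment> \<open>Here both coefficients are nonnegative, so every positive bound
        works.\<close>
      using assms by (intro that[of 1]) auto
  qed
  define v :: "real \<Rightarrow> real^2" where "v s = vector [1, s]" for s
  have v: "v s $ 1 = 1" "v s $ 2 = s" for s
    by (simp_all add: v_def)
  have nz: "v s \<noteq> 0" for s
    using v(1)[of s] by (metis zero_index zero_neq_one)
  \<comment> \<open>The first coordinate is the reciprocal of the norm, hence fixes the norm; the
    second coordinate then fixes \<open>s\<close>.\<close>
  have "inj (\<lambda>s. v s /\<^sub>R norm (v s))"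
  proof (rule injI)
    fix s t assume eq: "v s /\<^sub>R norm (v s) = v t /\<^sub>R norm (v t)"
    from arg_cong[OF eq, of "\<lambda>x. x $ 1"] have "norm (v s) = norm (v t)"
      by (simp add: v)
    with arg_cong[OF eq, of "\<lambda>x. x $ 2"] show "s = t"
      using nz[of t] by (simp add: v)
  qed
  then have "infinite ((\<lambda>s. v s /\<^sub>R norm (v s)) ` {0<..<\<delta>})"
    using \<delta>(1) by (simp add: finite_image_iff inj_on_subset)
  moreover have "(\<lambda>s. v s /\<^sub>R norm (v s)) ` {0<..<\<delta>} \<subseteq> {e. norm e = 1 \<and> 0 \<le> diag_form k l e}"
  proof clarify
    fix s assume "s \<in> {0<..<\<delta>}"
    moreover have "diag_form k l (v s /\<^sub>R norm (v s)) = (k + l * s\<^sup>2) / (norm (v s))\<^sup>2"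
      by (simp add: diag_form_def v field_simps add_divide_distrib)
    ultimately show "norm (v s /\<^sub>R norm (v s)) = 1 \<and> 0 \<le> diag_form k l (v s /\<^sub>R norm (v s))"
      using \<delta>(2) nz by simp
  qed
  ultimately show ?thesis
    using finite_subset by blast
qed

text \<open>Nonnegativity near the first axis settles all cases but d < \<gamma>, which is carried
  to that axis by exchanging the coordinates. Surjectivity of \<open>swap\<close> makes the preimage
  of an infinite set infinite.\<close>

lemma infinite_directions:
  assumes "0 < \<alpha>" "0 < \<gamma>" and d: "d < \<alpha> \<or> d < \<gamma> \<or> d \<le> \<alpha> \<and> d \<le> \<gamma>"
  shows "infinite (directions \<alpha> \<gamma> d)"
proof (cases "d < \<gamma>")
  case True
  define swap :: "real^2 \<Rightarrow> real^2" where "swap e = vector [e $ 2, e $ 1]" for e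
  have "directions \<alpha> \<gamma> d = swap -` {e. norm e = 1 \<and> 0 \<le> diag_form (1 - d/\<gamma>) (1 - d/\<alpha>) e}"
    by (auto simp: directions_eq norm_eq_1_iff_2 diag_form_def swap_def add.commute)
  moreover have "surj swap"
    by (rule surjI[of _ swap]) (simp add: swap_def vec_eq_iff forall_2)
  ultimately show ?thesis
    using infinite_diag_form_nonneg[of "1 - d/\<gamma>" "1 - d/\<alpha>"] True assms
    by (metis (no_types, lifting) diff_gt_0_iff_gt divide_less_eq_1_pos finite_imageI
        surj_image_vimage_eq)
next
  case False
  then show ?thesis
    using infinite_diag_form_nonneg[of "1 - d/\<alpha>" "1 - d/\<gamma>"] assms
    by (auto simp: directions_eq)
qed

text \<open>Both coefficients of the form are nonpositive, so nonnegativity of the sum forces both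
  terms to vanish. The coordinate with a strictly negative coefficient is then 0, which leaves the
  two unit vectors on the other axis.\<close>

lemma directions_subset_antipodal:
  assumes "0 < \<alpha>" "0 < \<gamma>" "\<alpha> \<le> d" "\<gamma> \<le> d" "\<alpha> < d \<or> \<gamma> < d"
  shows "\<exists>v. directions \<alpha> \<gamma> d \<subseteq> {v, - v}"
proof -
  have *: "(1 - d/\<alpha>) * (e $ 1)\<^sup>2 = 0" "(1 - d/\<gamma>) * (e $ 2)\<^sup>2 = 0" "(e $ 1)\<^sup>2 + (e $ 2)\<^sup>2 = 1"
    if "e \<in> directions \<alpha> \<gamma> d" for e
  proof -
    have "(1 - d/\<alpha>) * (e $ 1)\<^sup>2 \<le> 0" "(1 - d/\<gamma>) * (e $ 2)\<^sup>2 \<le> 0"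
      using assms by (auto intro!: mult_nonpos_nonneg)
    moreover have "0 \<le> (1 - d/\<alpha>) * (e $ 1)\<^sup>2 + (1 - d/\<gamma>) * (e $ 2)\<^sup>2"
      using that by (simp add: directions_eq diag_form_def)
    ultimately show "(1 - d/\<alpha>) * (e $ 1)\<^sup>2 = 0" "(1 - d/\<gamma>) * (e $ 2)\<^sup>2 = 0"
      by linarith+
    show "(e $ 1)\<^sup>2 + (e $ 2)\<^sup>2 = 1"
      using that by (simp add: directions_eq norm_eq_1_iff_2)
  qed
  show ?thesis
  proof (cases "\<alpha> < d")
    case True
    then have "directions \<alpha> \<gamma> d \<subseteq> {axis 2 1, - axis 2 1}"
      using * assms(1) by (force simp: vec_eq_iff forall_2 axis_def power2_eq_1_iff)
    then show ?thesis ..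
  next
    case False
    then have "directions \<alpha> \<gamma> d \<subseteq> {axis 1 1, - axis 1 1}"
      using * assms by (force simp: vec_eq_iff forall_2 axis_def power2_eq_1_iff)
    then show ?thesis ..
  qed
qed

section \<open>Ramp perturbations of the obstacles\<close>

text \<open>The sign of \<open>k\<close> is free so that both kinds of solution are covered: k > 0
  rises from the lower obstacle, k < 0 descends from the upper one.\<close>

definition ramp :: "(real^2 \<Rightarrow> real) \<Rightarrow> real \<Rightarrow> real^2 \<Rightarrow> real^2 \<Rightarrow> real" where
  "ramp p k e = (\<lambda>x. p x + k * (max (x \<bullet> e) 0)\<^sup>2)"

lemma inj_on_ramp:
  assumes "k \<noteq> 0"
  shows "inj_on (ramp p k) (sphere 0 1)"
proof (rule inj_onI)
  fix e f :: "real^2" assume "e \<in> sphere 0 1" "f \<in> sphere 0 1" and eq: "ramp p k e = ramp p k f"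
  then have n: "e \<bullet> e = 1" "f \<bullet> f = 1"
    by (auto simp: norm_eq_1)
  \<comment> \<open>Evaluation at \<open>e\<close> gives e . f = 1, the equality case of
    Cauchy-Schwarz for unit vectors.\<close>
  from fun_cong[OF eq, of e] have "(max (e \<bullet> f) 0)\<^sup>2 = 1"
    using assms n by (simp add: ramp_def)
  then have "e \<bullet> f = 1"
    by (auto simp: power2_eq_1_iff max_def split: if_splits)
  then have "(e - f) \<bullet> (e - f) = 0"
    using n by (simp add: inner_diff inner_commute)
  then show "e = f"
    by simp
qed

lemma free_boundary_ramp:
  assumes "k \<noteq> 0" "e \<noteq> 0"
  shows "free_boundary p (ramp p k e) = {x. e \<bullet> x = 0}"
proof -
  have "{x. ramp p k e x \<noteq> p x} = {x. e \<bullet> x > 0}"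
    using assms(1) by (auto simp: ramp_def max_def inner_commute)
  then show ?thesis
    using assms(2) by (simp add: free_boundary_def frontier_halfspace_gt)
qed

text \<open>In the plane a line through the origin is a hyperplane, and its unit normal gives the
  required ramp.\<close>

lemma rotationally_invariant_ramp:
  assumes "k \<noteq> 0"
  shows "rotationally_invariant p (ramp p k ` sphere 0 1)"
  unfolding rotationally_invariant_def
proof clarify
  fix L :: "(real^2) set" assume "subspace L" "dim L = 1"
  then obtain e where "e \<noteq> 0" and span_L: "span L = {x. e \<bullet> x = 0}"
    using lowdim_eq_hyperplane[of L] by auto
  have "free_boundary p (ramp p k (e /\<^sub>R norm e)) = L"
    using \<open>e \<noteq> 0\<close> \<open>subspace L\<close> span_L[symmetric] assms
    by (simp add: free_boundary_ramp span_eq_iff)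
  moreover have "e /\<^sub>R norm e \<in> sphere 0 1"
    using \<open>e \<noteq> 0\<close> by simp
  ultimately show "\<exists>u\<in>ramp p k ` sphere 0 1. free_boundary p u = L"
    by blast
qed

section \<open>Halfspace solutions as ramps over admissible directions\<close>

lemma halfspace_solutions_lower_eq:
  assumes "a1 < a2" "c1 < c2" "a1 + c1 < 0"
  shows "{u. halfspace_solution_lower (diag_form a1 c1) (diag_form a2 c2) u} =
    ramp (diag_form a1 c1) (- (a1 + c1)) ` directions (a2 - a1) (c2 - c1) (- (a1 + c1))"
    (is "?A = ramp ?p ?d ` ?E")
proof -
  have le: "(\<forall>x. ramp ?p ?d e x \<le> diag_form a2 c2 x) \<longleftrightarrow> e \<in> ?E" if "norm e = 1" for e
  proof -
    \<comment> \<open>Subtracting the lower obstacle turns the upper one into the gap between the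
      two.\<close>
    have "(\<forall>x. ramp ?p ?d e x \<le> diag_form a2 c2 x)
        \<longleftrightarrow> (\<forall>x. ?d * (max (x \<bullet> e) 0)\<^sup>2 \<le> diag_form (a2 - a1) (c2 - c1) x)"
      by (intro all_cong1) (auto simp: ramp_def diag_form_def left_diff_distrib)
    also have "\<dots> \<longleftrightarrow> ?d * diag_form (1/(a2 - a1)) (1/(c2 - c1)) e \<le> 1"
      using assms that by (intro ramp_le_diag_form_iff) auto
    finally show ?thesis
      using that by (simp add: directions_def)
  qed
  \<comment> \<open>The Laplacian of the obstacle is constant, so the defining equation determines
    \<open>u\<close> from \<open>e\<close>; \<open>m\<close> stands for the squared positive
    part.\<close>
  have "u x - diag_form a1 c1 x = - (2 * (a1 + c1) / 2) * m \<longleftrightarrow> u x = diag_form a1 c1 x + - (a1 + c1) * m" for u m and x :: "real^2"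
    by (auto simp: algebra_simps add_divide_distrib)
  then have "halfspace_solution_lower ?p (diag_form a2 c2) u
      \<longleftrightarrow> (\<exists>e. norm e = 1 \<and> u = ramp ?p ?d e \<and> (\<forall>x. u x \<le> diag_form a2 c2 x))" for u
    unfolding halfspace_solution_lower_def laplacian_diag_form ramp_def fun_eq_iff by blast
  then show ?thesis
    using le by (auto simp: directions_def)
qed

text \<open>The mirror image of the lower case: the ramp is subtracted from the upper obstacle, and
  staying above the lower one again bounds it by the gap.\<close>

lemma halfspace_solutions_upper_eq:
  assumes "a1 < a2" "c1 < c2" "a2 + c2 > 0"
  shows "{u. halfspace_solution_upper (diag_form a1 c1) (diag_form a2 c2) u} =
    ramp (diag_form a2 c2) (- (a2 + c2)) ` directions (a2 - a1) (c2 - c1) (a2 + c2)"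
    (is "?A = ramp ?p (- ?d) ` ?E")
proof -
  have ge: "(\<forall>x. diag_form a1 c1 x \<le> ramp ?p (- ?d) e x) \<longleftrightarrow> e \<in> ?E" if "norm e = 1" for e
  proof -
    have "(\<forall>x. diag_form a1 c1 x \<le> ramp ?p (- ?d) e x)
        \<longleftrightarrow> (\<forall>x. ?d * (max (x \<bullet> e) 0)\<^sup>2 \<le> diag_form (a2 - a1) (c2 - c1) x)"
      by (intro all_cong1) (auto simp: ramp_def diag_form_def algebra_simps)
    also have "\<dots> \<longleftrightarrow> ?d * diag_form (1/(a2 - a1)) (1/(c2 - c1)) e \<le> 1"
      using assms that by (intro ramp_le_diag_form_iff) auto
    finally show ?thesis
      using that by (simp add: directions_def)
  qed
  have "diag_form a2 c2 x - u x = 2 * (a2 + c2) / 2 * m \<longleftrightarrow> u x = diag_form a2 c2 x + - (a2 + c2) * m" for u m and x :: "real^2"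
    by (auto simp: algebra_simps add_divide_distrib)
  then have "halfspace_solution_upper (diag_form a1 c1) ?p u
      \<longleftrightarrow> (\<exists>e. norm e = 1 \<and> u = ramp ?p (- ?d) e \<and> (\<forall>x. diag_form a1 c1 x \<le> u x))" for u
    unfolding halfspace_solution_upper_def laplacian_diag_form ramp_def fun_eq_iff by blast
  then show ?thesis
    using ge by (auto simp: directions_def)
qed

lemma infinite_ramp_directions:
  assumes "0 < \<alpha>" "0 < \<gamma>" "k \<noteq> 0" "d < \<alpha> \<or> d < \<gamma> \<or> d \<le> \<alpha> \<and> d \<le> \<gamma>"
  shows "infinite (ramp p k ` directions \<alpha> \<gamma> d)"
proof -
  have "directions \<alpha> \<gamma> d \<subseteq> sphere 0 1"
    by (auto simp: directions_def)
  then show ?thesis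
    using assms infinite_directions inj_on_ramp
    by (metis finite_image_iff inj_on_subset)
qed

text \<open>There are at most two directions, and taking the image cannot increase their
  number.\<close>

lemma finite_card_ramp_directions:
  assumes "0 < \<alpha>" "0 < \<gamma>" "\<alpha> \<le> d" "\<gamma> \<le> d" "\<alpha> < d \<or> \<gamma> < d"
  shows "finite (ramp p k ` directions \<alpha> \<gamma> d) \<and> card (ramp p k ` directions \<alpha> \<gamma> d) \<le> 2"
proof -
  obtain v where v: "directions \<alpha> \<gamma> d \<subseteq> {v, - v}"
    using directions_subset_antipodal[OF assms] ..
  then have fin: "finite (directions \<alpha> \<gamma> d)"
    by (rule finite_subset) simp
  have "card (ramp p k ` directions \<alpha> \<gamma> d) \<le> card (directions \<alpha> \<gamma> d)"
    using fin by (rule card_image_le)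
  also have "\<dots> \<le> card {v, - v}"
    using v by (intro card_mono) auto
  also have "\<dots> \<le> 2"
    by (simp add: card_insert_if)
  finally show ?thesis
    using fin by simp
qed

section \<open>Classification by the signs of the coefficients of \<open>P\<close>\<close>

theorem corollary3p12:
  fixes a1 a2 c1 c2 :: real
    and p1 p2 P :: "real^2 \<Rightarrow> real"
  assumes "a1 < a2" and "c1 < c2" and "a1 + c1 < 0" and "a2 + c2 > 0"
    and "p1 = (\<lambda>x. a1 * (x $ 1)\<^sup>2 + c1 * (x $ 2)\<^sup>2)"
    and "p2 = (\<lambda>x. a2 * (x $ 1)\<^sup>2 + c2 * (x $ 2)\<^sup>2)"
    and "P = (\<lambda>x. p1 x + p2 (vector [x $ 2, x $ 1]))"
  shows
    "((\<forall>x. P x = 0) \<longrightarrow>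
        infinite {u. halfspace_solution_lower p1 p2 u} \<and>
        rotationally_invariant p1 {u. halfspace_solution_lower p1 p2 u} \<and>
        infinite {u. halfspace_solution_upper p1 p2 u} \<and>
        rotationally_invariant p2 {u. halfspace_solution_upper p1 p2 u}) \<and>
     (changes_sign P \<longrightarrow>
        infinite {u. halfspace_solution_lower p1 p2 u} \<and>
        infinite {u. halfspace_solution_upper p1 p2 u}) \<and>
     (has_sign P \<longrightarrow>
        ((\<forall>x. P x \<ge> 0) \<longrightarrow>
           infinite {u. halfspace_solution_lower p1 p2 u} \<and>
           rotationally_invariant p1 {u. halfspace_solution_lower p1 p2 u} \<and>
           finite {u. halfspace_solution_upper p1 p2 u} \<and>
           card {u. halfspace_solution_upper p1 p2 u} \<le> 2) \<and>
        ((\<forall>x. P x \<le> 0) \<longrightarrow>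
           infinite {u. halfspace_solution_upper p1 p2 u} \<and>
           rotationally_invariant p2 {u. halfspace_solution_upper p1 p2 u} \<and>
           finite {u. halfspace_solution_lower p1 p2 u} \<and>
           card {u. halfspace_solution_lower p1 p2 u} \<le> 2))"
proof -
  define \<alpha> \<gamma> where "\<alpha> = a2 - a1" and "\<gamma> = c2 - c1"
  \<comment> \<open>These are the coefficients of \<open>P\<close>. For d = - (a1 + c1) one has
    \<alpha> - d = B and \<gamma> - d = A; for d = a2 + c2 one has \<alpha> - d = - A and \<gamma> -
    d = - B. Comparing \<open>d\<close> with \<alpha> and \<gamma> thus amounts to reading off the
    signs of \<open>A\<close> and \<open>B\<close>.\<close>
  define A B where "A = a1 + c2" and "B = c1 + a2"
  have p: "p1 = diag_form a1 c1" "p2 = diag_form a2 c2"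
    using assms by (simp_all add: diag_form_def)
  have P: "P = diag_form A B"
    using assms by (auto simp: diag_form_def A_def B_def fun_eq_iff algebra_simps)
  have pos: "0 < \<alpha>" "0 < \<gamma>" "- (a1 + c1) \<noteq> 0" "- (a2 + c2) \<noteq> 0"
    using assms by (auto simp: \<alpha>_def \<gamma>_def)
  have lower: "{u. halfspace_solution_lower p1 p2 u} =
      ramp p1 (- (a1 + c1)) ` directions \<alpha> \<gamma> (- (a1 + c1))"
    unfolding p \<alpha>_def \<gamma>_def using assms by (intro halfspace_solutions_lower_eq)
  have upper: "{u. halfspace_solution_upper p1 p2 u} =
      ramp p2 (- (a2 + c2)) ` directions \<alpha> \<gamma> (a2 + c2)"
    unfolding p \<alpha>_def \<gamma>_def using assms by (intro halfspace_solutions_upper_eq)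
  have lower_inf: "infinite {u. halfspace_solution_lower p1 p2 u}"
    if "0 < A \<or> 0 < B \<or> 0 \<le> A \<and> 0 \<le> B"
    unfolding lower using pos that
    by (intro infinite_ramp_directions) (auto simp: A_def B_def \<alpha>_def \<gamma>_def)
  have upper_inf: "infinite {u. halfspace_solution_upper p1 p2 u}"
    if "A < 0 \<or> B < 0 \<or> A \<le> 0 \<and> B \<le> 0"
    unfolding upper using pos that
    by (intro infinite_ramp_directions) (auto simp: A_def B_def \<alpha>_def \<gamma>_def)
  have lower_rot: "rotationally_invariant p1 {u. halfspace_solution_lower p1 p2 u}"
    if "0 \<le> A" "0 \<le> B"
  proof -
    have "directions \<alpha> \<gamma> (- (a1 + c1)) = sphere 0 1"
      using pos that by (intro directions_eq_sphere) (auto simp: A_def B_def \<alpha>_def \<gamma>_def)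
    with rotationally_invariant_ramp[OF pos(3)] show ?thesis
      unfolding lower by simp
  qed
  have upper_rot: "rotationally_invariant p2 {u. halfspace_solution_upper p1 p2 u}"
    if "A \<le> 0" "B \<le> 0"
  proof -
    have "directions \<alpha> \<gamma> (a2 + c2) = sphere 0 1"
      using pos that by (intro directions_eq_sphere) (auto simp: A_def B_def \<alpha>_def \<gamma>_def)
    with rotationally_invariant_ramp[OF pos(4)] show ?thesis
      unfolding upper by simp
  qed
  have lower_fin: "finite {u. halfspace_solution_lower p1 p2 u} \<and>
      card {u. halfspace_solution_lower p1 p2 u} \<le> 2"
    if "A \<le> 0" "B \<le> 0" "A < 0 \<or> B < 0"
    unfolding lower using pos that
    by (intro finite_card_ramp_directions) (auto simp: A_def B_def \<alpha>_def \<gamma>_def)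
  have upper_fin: "finite {u. halfspace_solution_upper p1 p2 u} \<and>
      card {u. halfspace_solution_upper p1 p2 u} \<le> 2"
    if "0 \<le> A" "0 \<le> B" "0 < A \<or> 0 < B"
    unfolding upper using pos that
    by (intro finite_card_ramp_directions) (auto simp: A_def B_def \<alpha>_def \<gamma>_def)
  \<comment> \<open>Values on the axes transfer sign information from \<open>P\<close> to its
    coefficients.\<close>
  have PA: "P (axis 1 1) = A" and PB: "P (axis 2 1) = B"
    by (simp_all add: P diag_form_def axis_def)
  show ?thesis
  proof (intro conjI[of "_ \<longrightarrow> _"] impI)
    assume "\<forall>x. P x = 0"
    then have "A = 0" "B = 0"
      using PA PB by auto
    then show "infinite {u. halfspace_solution_lower p1 p2 u} \<and>
        rotationally_invariant p1 {u. halfspace_solution_lower p1 p2 u} \<and>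
        infinite {u. halfspace_solution_upper p1 p2 u} \<and>
        rotationally_invariant p2 {u. halfspace_solution_upper p1 p2 u}"
      using lower_inf lower_rot upper_inf upper_rot by simp
  next
    assume "changes_sign P"
    then obtain x y where xy: "P x > 0" "P y < 0"
      by (auto simp: changes_sign_def)
    \<comment> \<open>If neither coefficient were positive, or neither negative, \<open>P\<close>
      could not take both signs.\<close>
    have "P x \<le> 0" if "A \<le> 0" "B \<le> 0"
      using that by (simp add: P diag_form_def add_nonpos_nonpos mult_nonpos_nonneg)
    moreover have "P y \<ge> 0" if "A \<ge> 0" "B \<ge> 0"
      using that by (simp add: P diag_form_def)
    ultimately have "A > 0 \<or> B > 0" "A < 0 \<or> B < 0"
      using xy by force+
    then show "infinite {u. halfspace_solution_lower p1 p2 u} \<and>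
        infinite {u. halfspace_solution_upper p1 p2 u}"
      using lower_inf upper_inf by blast
  next
    assume "has_sign P" "\<forall>x. P x \<ge> 0"
    then have "0 \<le> A" "0 \<le> B"
      using PA PB by metis+
    moreover have "A \<noteq> 0 \<or> B \<noteq> 0"
      using \<open>has_sign P\<close> by (auto simp: has_sign_def P diag_form_def)
    ultimately show "infinite {u. halfspace_solution_lower p1 p2 u} \<and>
        rotationally_invariant p1 {u. halfspace_solution_lower p1 p2 u} \<and>
        finite {u. halfspace_solution_upper p1 p2 u} \<and>
        card {u. halfspace_solution_upper p1 p2 u} \<le> 2"
      using lower_inf lower_rot upper_fin by auto
  next
    assume "has_sign P" "\<forall>x. P x \<le> 0"
    then have "A \<le> 0" "B \<le> 0"
      using PA PB by metis+
    moreover have "A \<noteq> 0 \<or> B \<noteq> 0"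
      using \<open>has_sign P\<close> by (auto simp: has_sign_def P diag_form_def)
    ultimately show "infinite {u. halfspace_solution_upper p1 p2 u} \<and>
        rotationally_invariant p2 {u. halfspace_solution_upper p1 p2 u} \<and>
        finite {u. halfspace_solution_lower p1 p2 u} \<and>
        card {u. halfspace_solution_lower p1 p2 u} \<le> 2"
      using upper_inf upper_rot lower_fin by auto
  qed
qed

end
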